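(* Let $\alpha\in\mathbb{R}\setminus\frac{\pi}{2}\mathbb{Z}$ and let $u,v$ be two combinations of shifted Gaussians on $\mathbb{R}$. If $|\mathcal{F}_\alpha v|=|\mathcal{F}_\alpha u|$, then there exists $c\in\mathbb{C}$ with $|c|=1$ such that $v=cu$.
   Context: A function $u\in L^2(\mathbb{R})$ is a combination of shifted Gaussians if there exist an integer $N$, complex numbers $c_1,\ldots,c_N$ and real numbers $t_1,\ldots,t_N$ such that $u(t)=\sum_{j=1}^N c_j\gamma(t-t_j)$, where $\gamma(t)=e^{-\pi t^2}$. (The integer $N$, coefficients and shifts may be different for $u$ and $v$.) Fractional Fourier transform on $\mathbb{R}$: for $\alpha\in\mathbb{R}\setminus\pi\mathbb{Z}$ put $c_\alpha=\frac{\exp\left(\frac{i}{2}\left(\alpha-\frac{\pi}{2}\right)\right)}{\sqrt{|\sin\alpha|}}$ and, for $u\in L^1(\mathbb{R})\cap L^2(\mathbb{R})$, $$\mathcal{F}_\alpha u(\xi)=c_\alpha e^{-i\pi \xi^2\cot\alpha}\int_{\mathbb{R}}u(t)e^{-i\pi t^2\cot\alpha}e^{-2i\pi t\xi/\sin\alpha}\,dt .$$ *)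

theory Defs
  imports "HOL-Probability.Distributions"
begin

definition L1_fun :: "(real \<Rightarrow> complex) \<Rightarrow> bool" where
  "L1_fun u \<longleftrightarrow> integrable lborel u"

definition L2_fun :: "(real \<Rightarrow> complex) \<Rightarrow> bool" where
  "L2_fun u \<longleftrightarrow> u \<in> borel_measurable lborel \<and> integrable lborel (\<lambda>x. (cmod (u x))\<^sup>2)"

definition gauss :: "real \<Rightarrow> real" where
  "gauss t = exp (- pi * t\<^sup>2)"

definition shifted_gauss_comb :: "(real \<Rightarrow> complex) \<Rightarrow> bool" where
  "shifted_gauss_comb u \<longleftrightarrow> L2_fun u \<and>
     (\<exists>(N::nat) (c :: nat \<Rightarrow> complex) (s :: nat \<Rightarrow> real).
        \<forall>t. u t = (\<Sum>j=1..N. c j * of_real (gauss (t - s j))))"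

definition frft_const :: "real \<Rightarrow> complex" where
  "frft_const \<alpha> = exp (\<i> / 2 * of_real (\<alpha> - pi / 2)) / of_real (sqrt \<bar>sin \<alpha>\<bar>)"

text \<open>
  The formula below is the fractional Fourier transform only for \<open>\<alpha> \<notin> \<pi>\<int>\<close> and
  \<open>u \<in> L\<^sup>1 \<inter> L\<^sup>2\<close>; elsewhere the value carries no meaning.
\<close>
definition frft :: "real \<Rightarrow> (real \<Rightarrow> complex) \<Rightarrow> real \<Rightarrow> complex" where
  "frft \<alpha> u \<xi> =
     frft_const \<alpha> * exp (- \<i> * of_real (pi * \<xi>\<^sup>2 * cot \<alpha>)) *
     (LINT t|lborel. u t * exp (- \<i> * of_real (pi * t\<^sup>2 * cot \<alpha>))
                         * exp (- 2 * \<i> * of_real (pi * t * \<xi> / sin \<alpha>)))"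

text \<open>
  The square integrability in \<open>shifted_gauss_comb\<close> excludes no combination, and all of
  them lie in the domain \<open>L\<^sup>1 \<inter> L\<^sup>2\<close> of \<open>frft\<close>.
\<close>

lemma integrable_gauss_shift: "integrable lborel (\<lambda>t. gauss (t - s))"
proof -
  have "integrable lborel (\<lambda>t. normal_density s (1 / sqrt (2 * pi)) t)"
    by (intro integrable_normal_density) simp
  moreover have "normal_density s (1 / sqrt (2 * pi)) t = gauss (t - s)" for t
    by (simp add: normal_density_def gauss_def power_divide field_simps)
  ultimately show ?thesis by simp
qed

lemma gauss_comb_L1:
  "L1_fun (\<lambda>t. \<Sum>j=1..(N::nat). c j * of_real (gauss (t - s j)))"
  unfolding L1_fun_def
  by (intro Bochner_Integration.integrable_sum integrable_mult_right integrable_of_real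
        integrable_gauss_shift)

lemma gauss_comb_L2:
  "L2_fun (\<lambda>t. \<Sum>j=1..(N::nat). c j * of_real (gauss (t - s j)))"
proof -
  let ?u = "\<lambda>t. \<Sum>j=1..N. c j * complex_of_real (gauss (t - s j))"
  define B where "B = (\<Sum>j=1..N. cmod (c j))"
  have int: "integrable lborel ?u"
    using gauss_comb_L1[unfolded L1_fun_def] .
  have le: "cmod (?u t) \<le> B" for t
  proof -
    have "cmod (c j * complex_of_real (gauss (t - s j))) \<le> cmod (c j)" for j
      by (simp add: norm_mult gauss_def mult_left_le)
    then show ?thesis
      unfolding B_def by (intro order_trans[OF norm_sum] sum_mono)
  qed
  have meas: "?u \<in> borel_measurable lborel"
    using int by (rule borel_measurable_integrable)
  have "integrable lborel (\<lambda>t. (cmod (?u t))\<^sup>2)"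
  proof (rule Bochner_Integration.integrable_bound)
    show "integrable lborel (\<lambda>t. B * cmod (?u t))"
      using int by (intro integrable_mult_right integrable_norm)
    show "(\<lambda>t. (cmod (?u t))\<^sup>2) \<in> borel_measurable lborel"
      using meas by measurable
    have "norm ((cmod (?u t))\<^sup>2) \<le> norm (B * cmod (?u t))" for t
      using mult_right_mono[OF le[of t] norm_ge_zero[of "?u t"]]
      using order_trans[OF norm_ge_zero le[of t]] by (simp add: power2_eq_square abs_mult)
    then show "AE t in lborel. norm ((cmod (?u t))\<^sup>2) \<le> norm (B * cmod (?u t))"
      by simp
  qed
  with meas show ?thesis by (simp add: L2_fun_def)
qed

end

theory Submission
  imports Defs
begin

text \<open>
  Write \<open>p = 1 + \<i> cot \<alpha>\<close>, and let \<open>u\<close> be the sum of \<open>C a * gauss (t - a)\<close> over a finite set \<open>S\<close> of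
  shifts. By the formula for Gaussian integrals with complex parameters (\<open>gaussian_integral\<close>), the
  transform of \<open>u\<close> at \<open>x sin \<alpha>\<close> is a nonvanishing factor common to all combinations times the
  exponential sum \<open>\<Sum>a\<in>S. C a * q a * exp (w * a * x)\<close>, where \<open>q a \<noteq> 0\<close> and \<open>w = - 2 \<pi> \<i> / p\<close>
  (\<open>frft_gauss_sum\<close>).

  The squared modulus of such a sum, with coefficients \<open>D a\<close>, is again an exponential sum in \<open>x\<close>, with
  coefficient \<open>D a * cnj (D b)\<close> at the frequency \<open>w * a + cnj w * b\<close>. Neither the real nor the
  imaginary part of \<open>w\<close> vanishes, because \<open>cot \<alpha> \<noteq> 0\<close>; hence \<open>w\<close> and \<open>cnj w\<close> are linearly independent
  over the reals and distinct pairs \<open>(a, b)\<close> have distinct frequencies. Exponentials with distinct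
  frequencies are linearly independent (\<open>exponentials_linearly_independent\<close>), so the modulus of the
  transform determines every product \<open>D a * cnj (D b)\<close>
  (\<open>modulus_of_exponential_sum_determines_products\<close>), and these products determine \<open>D\<close> up to a
  unimodular factor (\<open>equal_products_imp_unimodular_multiple\<close>). If \<open>cot \<alpha> = 0\<close>, the number \<open>w\<close> is
  purely imaginary, the frequencies depend only on \<open>a - b\<close>, and the argument breaks down.
\<close>

section \<open>Gaussian integrals with complex parameters\<close>

lemma integral_total_derivative_eq_0:
  fixes L l :: "real \<Rightarrow> complex"
  assumes L: "\<And>t. (L has_vector_derivative l t) (at t)"
    and l: "continuous_on UNIV l" "integrable lborel l"
    and top: "(L \<longlongrightarrow> 0) at_top" and bot: "(L \<longlongrightarrow> 0) at_bot"
  shows "(LINT t|lborel. l t) = 0"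
proof -
  have "(LBINT t=-\<infinity>..\<infinity>. l t) = 0 - 0"
  proof (rule interval_integral_FTC_integrable[where F = L])
    show "isCont l x" for x
      using l(1) continuous_on_eq_continuous_at by blast
    show "set_integrable lborel (einterval (- \<infinity>) \<infinity>) l"
      using l(2) by (simp add: set_integrable_def)
    show "((L \<circ> real_of_ereal) \<longlongrightarrow> 0) (at_right (- \<infinity>))"
         "((L \<circ> real_of_ereal) \<longlongrightarrow> 0) (at_left \<infinity>)"
      using top bot by (simp_all add: ereal_tendsto_simps1)
  qed (use L in auto)
  then show ?thesis
    by (simp add: interval_lebesgue_integral_def set_lebesgue_integral_def)
qed

text \<open>
  Differentiation under the integral sign for a family \<open>K s\<close> whose derivative in the parameter \<open>s\<close> is
  also the derivative in \<open>t\<close> of a decaying function: the integral cannot depend on \<open>s\<close>. Integrating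
  the common derivative \<open>k\<close> over the strip \<open>{0..1} \<times> \<real>\<close> first in \<open>s\<close> gives the change of the integral,
  and first in \<open>t\<close> gives zero; the bound \<open>g\<close> justifies Fubini.
\<close>
lemma integral_deformation:
  fixes K L k :: "real \<Rightarrow> real \<Rightarrow> complex" and g :: "real \<Rightarrow> real"
  assumes dK: "\<And>s t. s \<in> {0..1} \<Longrightarrow> ((\<lambda>s. K s t) has_vector_derivative k s t) (at s within {0..1})"
    and dL: "\<And>s t. s \<in> {0..1} \<Longrightarrow> (L s has_vector_derivative k s t) (at t)"
    and k: "continuous_on ({0..1} \<times> UNIV) (\<lambda>(s, t). k s t)"
    and kg: "\<And>s t. s \<in> {0..1} \<Longrightarrow> cmod (k s t) \<le> g t"
    and Lg: "\<And>s t. s \<in> {0..1} \<Longrightarrow> cmod (L s t) \<le> g t"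
    and g: "integrable lborel g" "(g \<longlongrightarrow> 0) at_top" "(g \<longlongrightarrow> 0) at_bot"
    and K: "integrable lborel (K 0)" "integrable lborel (K 1)"
  shows "(LINT t|lborel. K 1 t) = (LINT t|lborel. K 0 t)"
proof -
  define f where "f s t = indicator {0..1} s *\<^sub>R k s t" for s t
  have [measurable]: "g \<in> borel_measurable borel"
    using borel_measurable_integrable[OF g(1)] by simp
  have f_meas: "case_prod f \<in> borel_measurable (lborel \<Otimes>\<^sub>M lborel)"
  proof -
    have "(\<lambda>x. indicator ({0..1::real} \<times> (UNIV::real set)) x *\<^sub>R (case x of (s, t) \<Rightarrow> k s t))
        \<in> borel_measurable borel"
      by (intro borel_measurable_continuous_on_indicator k borel_closed closed_Times) auto
    also have "(\<lambda>x. indicator ({0..1::real} \<times> (UNIV::real set)) x *\<^sub>R (case x of (s, t) \<Rightarrow> k s t))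
        = case_prod f"
      by (auto simp: f_def fun_eq_iff indicator_def)
    finally show ?thesis by (simp add: lborel_prod)
  qed
  have dom: "integrable (lborel \<Otimes>\<^sub>M lborel) (\<lambda>(s::real, t). indicator {0..1} s * g t)"
    by (rule lborel_pair.Fubini_integrable) (use g(1) in \<open>auto simp: abs_mult\<close>)
  have f_int: "integrable (lborel \<Otimes>\<^sub>M lborel) (case_prod f)"
  proof (rule Bochner_Integration.integrable_bound[OF dom f_meas], intro always_eventually allI)
    fix x :: "real \<times> real"
    show "norm (case_prod f x) \<le> norm (case x of (s, t) \<Rightarrow> indicator {0..1} s * g t)"
      using kg by (cases x) (auto simp: f_def indicator_def intro: order_trans[OF _ abs_ge_self])
  qed
  have inner_s: "(LINT s|lborel. f s t) = K 1 t - K 0 t" for t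
    unfolding f_def
  proof (rule integral_FTC_Icc)
    have "continuous_on {0..1} ((\<lambda>(s, t). k s t) \<circ> (\<lambda>s. (s, t)))"
      by (intro continuous_on_compose continuous_intros continuous_on_subset[OF k]) auto
    then show "continuous_on {0..1} (\<lambda>s. k s t)" by (simp add: o_def)
  qed (use dK in auto)
  have inner_t: "(LINT t|lborel. f s t) = 0" for s
  proof (cases "s \<in> {0..1}")
    case s: True
    have cont: "continuous_on UNIV (k s)"
    proof -
      have "continuous_on UNIV ((\<lambda>(s, t). k s t) \<circ> (\<lambda>t. (s, t)))"
        by (intro continuous_on_compose continuous_intros continuous_on_subset[OF k]) (use s in auto)
      then show ?thesis by (simp add: o_def)
    qed
    have "(LINT t|lborel. k s t) = 0"
    proof (rule integral_total_derivative_eq_0[OF dL[OF s] cont])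
      show "integrable lborel (k s)"
        using kg[OF s] borel_measurable_continuous_onI[OF cont]
        by (intro Bochner_Integration.integrable_bound[OF g(1)])
           (auto intro: order_trans[OF _ abs_ge_self])
      show "(L s \<longlongrightarrow> 0) at_top"
        by (rule Lim_null_comparison[OF _ g(2)]) (use Lg[OF s] in auto)
      show "(L s \<longlongrightarrow> 0) at_bot"
        by (rule Lim_null_comparison[OF _ g(3)]) (use Lg[OF s] in auto)
    qed
    with s show ?thesis by (simp add: f_def)
  qed (simp add: f_def)
  have "(LINT t|lborel. K 1 t) - (LINT t|lborel. K 0 t) = (LINT t|lborel. LINT s|lborel. f s t)"
    using K by (simp add: inner_s)
  also have "\<dots> = (LINT s|lborel. LINT t|lborel. f s t)"
    by (rule lborel_pair.Fubini_integral[OF f_int])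
  also have "\<dots> = 0" by (simp add: inner_t)
  finally show ?thesis by simp
qed

text \<open>
  An exponentially growing factor costs only part of the Gaussian decay: the rate drops from \<open>\<pi> r\<close> to
  \<open>r\<close>, and completing the square in the surplus, at least \<open>2 r t\<^sup>2\<close> since \<open>\<pi> > 3\<close>, bounds the rest.
\<close>
lemma gauss_dominates:
  assumes "r > 0"
  shows "exp (- pi * r * t\<^sup>2 + M * \<bar>t\<bar>) \<le> exp (M\<^sup>2 / (8 * r)) * exp (- r * t\<^sup>2)"
proof -
  have "0 \<le> (4 * r * \<bar>t\<bar> - M)\<^sup>2 / (8 * r)"
    using assms by simp
  also have "\<dots> = 2 * r * t\<^sup>2 - M * \<bar>t\<bar> + M\<^sup>2 / (8 * r)"
    using assms by (simp add: power2_eq_square field_simps abs_if)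
  finally have "0 \<le> 2 * r * t\<^sup>2 - M * \<bar>t\<bar> + M\<^sup>2 / (8 * r)" .
  moreover have "3 * (r * t\<^sup>2) \<le> pi * (r * t\<^sup>2)"
    using assms pi_gt3 by (intro mult_right_mono) auto
  ultimately show ?thesis
    by (simp add: exp_add[symmetric] algebra_simps)
qed

lemma integrable_exp_neg_square:
  assumes "r > 0"
  shows "integrable lborel (\<lambda>t::real. exp (- r * t\<^sup>2))"
proof -
  have "integrable lborel (\<lambda>t. sqrt (pi / r) * normal_density 0 (1 / sqrt (2 * r)) t)"
    using assms by (intro integrable_mult_right integrable_normal_density) simp
  moreover have "sqrt (pi / r) * normal_density 0 (1 / sqrt (2 * r)) t = exp (- r * t\<^sup>2)" for t
    using assms by (simp add: normal_density_def power_divide real_sqrt_divide real_sqrt_mult field_simps)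
  ultimately show ?thesis by simp
qed

lemma exp_neg_square_tendsto_0:
  assumes "r > 0"
  shows "((\<lambda>t::real. C * exp (- r * t\<^sup>2)) \<longlongrightarrow> 0) at_top"
    and "((\<lambda>t::real. C * exp (- r * t\<^sup>2)) \<longlongrightarrow> 0) at_bot"
proof -
  have *: "((\<lambda>t::real. C * exp (- r * t\<^sup>2)) \<longlongrightarrow> 0) F" if "LIM t F. t\<^sup>2 :> at_top" for F
  proof -
    have "LIM t F. - r * t\<^sup>2 :> at_bot"
      using filterlim_tendsto_neg_mult_at_bot[OF tendsto_const _ that, of "- r"] assms by simp
    then have "((\<lambda>t. exp (- r * t\<^sup>2)) \<longlongrightarrow> 0) F"
      by (rule filterlim_compose[OF exp_at_bot])
    then show ?thesis by (rule tendsto_mult_right_zero)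
  qed
  show "((\<lambda>t::real. C * exp (- r * t\<^sup>2)) \<longlongrightarrow> 0) at_top"
    by (intro * filterlim_pow_at_top filterlim_ident) simp
  show "((\<lambda>t::real. C * exp (- r * t\<^sup>2)) \<longlongrightarrow> 0) at_bot"
    by (intro * filterlim_pow_at_bot_even filterlim_ident) simp_all
qed

lemma gauss_integral_real: "(LINT t|lborel. exp (- pi * t\<^sup>2)) = 1"
proof -
  have "normal_density 0 (1 / sqrt (2 * pi)) t = exp (- pi * t\<^sup>2)" for t
    by (simp add: normal_density_def power_divide field_simps)
  then show ?thesis
    using integral_normal_density[of "1 / sqrt (2 * pi)" 0] by simp
qed

text \<open>
  Deform the parameters linearly from \<open>(1, 0)\<close> to \<open>(p, b)\<close>, with \<open>P s = 1 + s (p - 1)\<close> and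
  \<open>B s = s b\<close>; the half plane \<open>Re z > 0\<close> is convex, so \<open>P s\<close> stays in it. Multiplied by the inverse
  \<open>m s\<close> of the claimed value, the integrand is the standard Gaussian after the complex affine
  substitution \<open>t \<mapsto> sqrt (P s) * (t - B s / P s)\<close>, times the Jacobian \<open>sqrt (P s)\<close>.
  Moving \<open>s\<close> therefore acts as an infinitesimal affine change of variables: the derivative in \<open>s\<close> is the derivative in \<open>t\<close> of the integrand times a
  polynomial \<open>l\<close> of degree one in \<open>t\<close>, and \<open>integral_deformation\<close> reduces the claim to the real
  Gaussian.
\<close>
lemma gaussian_integral:
  fixes p b :: complex
  assumes "Re p > 0"
  shows gaussian_integrable:
      "integrable lborel (\<lambda>t. exp (- of_real pi * p * (of_real t)\<^sup>2 + 2 * of_real pi * b * of_real t))"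
    and gaussian_integral_eq:
      "(LINT t|lborel. exp (- of_real pi * p * (of_real t)\<^sup>2 + 2 * of_real pi * b * of_real t))
        = exp (of_real pi * b\<^sup>2 / p) / csqrt p"
proof -
  define P where "P z = 1 + z * (p - 1)" for z
  define B where "B z = z * b" for z
  define m where "m z = csqrt (P z) * exp (- of_real pi * (B z)\<^sup>2 / P z)" for z
  define e where "e z t = exp (- of_real pi * P z * (of_real t)\<^sup>2 + 2 * of_real pi * B z * of_real t)"
    for z :: complex and t :: real
  \<comment> \<open>The coefficients of \<open>l\<close> come from comparing powers of \<open>t\<close> in the two derivatives: \<open>t\<^sup>2\<close> forces
    \<open>\<alpha>\<close>, then \<open>t\<close> forces \<open>\<beta>\<close>, and the constant terms agree by the choice of \<open>m\<close>.\<close>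
  define \<alpha> where "\<alpha> z = (p - 1) / (2 * P z)" for z
  define \<beta> where "\<beta> z = (B z * \<alpha> z - b) / P z" for z
  define l where "l z t = \<alpha> z * of_real t + \<beta> z" for z :: complex and t :: real
  define q where "q z t = \<alpha> z + l z t * (- 2 * of_real pi * P z * of_real t + 2 * of_real pi * B z)"
    for z :: complex and t :: real
  \<comment> \<open>A lower bound for the real part of \<open>P s\<close> on the whole path.\<close>
  define r where "r = min 1 (Re p)"
  have r: "r > 0" using assms by (simp add: r_def)
  have ReP: "Re (P (of_real s)) \<ge> r" if "s \<in> {0..1}" for s
  proof -
    have "r = (1 - s) * r + s * r" by (simp add: algebra_simps)
    also have "\<dots> \<le> (1 - s) * 1 + s * Re p"
      using that by (intro add_mono mult_left_mono) (auto simp: r_def)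
    finally show ?thesis by (simp add: P_def algebra_simps)
  qed
  have Pn: "P (of_real s) \<notin> \<real>\<^sub>\<le>\<^sub>0" and P0: "P (of_real s) \<noteq> 0" if "s \<in> {0..1}" for s
    using ReP[OF that] r by (auto simp: complex_nonpos_Reals_iff)

  have dK: "((\<lambda>s. m (of_real s) * e (of_real s) t) has_vector_derivative
      m (of_real s) * e (of_real s) t * q (of_real s) t) (at s within {0..1})"
    if s: "s \<in> {0..1}" for s t
  proof (rule has_vector_derivative_real_field, rule has_field_derivative_at_within)
    let ?z = "complex_of_real s"
    have dP: "(P has_field_derivative (p - 1)) (at z)" for z
      unfolding P_def by (auto intro!: derivative_eq_intros)
    have dB: "(B has_field_derivative b) (at z)" for z
      unfolding B_def by (auto intro!: derivative_eq_intros)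
    have sq: "(p - 1) / (2 * csqrt (P ?z)) = csqrt (P ?z) * \<alpha> ?z"
      using P0[OF s] by (simp add: \<alpha>_def divide_simps) (metis power2_csqrt power2_eq_square)
    have d1: "((\<lambda>z. csqrt (P z)) has_field_derivative csqrt (P ?z) * \<alpha> ?z) (at ?z)"
      unfolding sq[symmetric] by (rule has_field_derivative_csqrt'[OF dP Pn[OF s]])
    have d2: "((\<lambda>z. - of_real pi * (B z)\<^sup>2 / P z) has_field_derivative
        - of_real pi * (2 * B ?z * b * P ?z - (B ?z)\<^sup>2 * (p - 1)) / (P ?z)\<^sup>2) (at ?z)"
      using P0[OF s] by (auto intro!: derivative_eq_intros dP dB simp: power2_eq_square field_simps)
    have d3: "((\<lambda>z. - of_real pi * P z * (of_real t)\<^sup>2 + 2 * of_real pi * B z * of_real t)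
        has_field_derivative - of_real pi * (p - 1) * (of_real t)\<^sup>2 + 2 * of_real pi * b * of_real t) (at ?z)"
      by (auto intro!: derivative_eq_intros dP dB)
    have alg: "q ?z t = \<alpha> ?z + (- of_real pi * (2 * B ?z * b * P ?z - (B ?z)\<^sup>2 * (p - 1)) / (P ?z)\<^sup>2)
        + (- of_real pi * (p - 1) * (of_real t)\<^sup>2 + 2 * of_real pi * b * of_real t)"
      using P0[OF s] by (simp add: q_def l_def \<beta>_def \<alpha>_def power2_eq_square divide_simps) (simp add: algebra_simps)
    have ring: "(c * a * E + E * x * c) * F + F * y * (c * E) = c * E * F * (a + x + y)"
      for c a E x F y :: complex by algebra
    show "((\<lambda>z. m z * e z t) has_field_derivative m ?z * e ?z t * q ?z t) (at ?z)"
      unfolding m_def e_def alg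
      by (rule DERIV_cong[OF DERIV_mult[OF DERIV_mult[OF d1 DERIV_fun_exp[OF d2]] DERIV_fun_exp[OF d3]]])
         (rule ring)
  qed

  have dL: "((\<lambda>t. m (of_real s) * e (of_real s) t * l (of_real s) t) has_vector_derivative
      m (of_real s) * e (of_real s) t * q (of_real s) t) (at t)" for s t
  proof -
    let ?z = "complex_of_real s"
    have "((\<lambda>w. m ?z * exp (- of_real pi * P ?z * w\<^sup>2 + 2 * of_real pi * B ?z * w) * (\<alpha> ?z * w + \<beta> ?z))
      has_field_derivative m ?z * e ?z t * q ?z t) (at (of_real t))"
      unfolding e_def q_def l_def
      by (auto intro!: derivative_eq_intros simp: algebra_simps power2_eq_square)
    from has_vector_derivative_real_field[OF this] show ?thesis
      by (simp add: e_def l_def)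
  qed

  have contP: "continuous_on S (\<lambda>x. P (f x))" if "continuous_on S f" for S and f :: "'z::topological_space \<Rightarrow> complex"
    unfolding P_def by (intro continuous_intros that)
  have contB: "continuous_on S (\<lambda>x. B (f x))" if "continuous_on S f" for S and f :: "'z::topological_space \<Rightarrow> complex"
    unfolding B_def by (intro continuous_intros that)
  have c\<alpha>: "continuous_on {0..1} (\<lambda>s. \<alpha> (of_real s))"
    unfolding \<alpha>_def by (intro continuous_intros contP) (use P0 in auto)
  have c\<beta>: "continuous_on {0..1} (\<lambda>s. \<beta> (of_real s))"
    unfolding \<beta>_def by (intro continuous_intros contP contB c\<alpha>) (use P0 in auto)
  have cm: "continuous_on {0..1} (\<lambda>s. m (of_real s))"
    unfolding m_def
    by (intro continuous_intros contP contB continuous_on_compose2[OF continuous_on_csqrt])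
       (use P0 Pn in auto)
  have ck: "continuous_on ({0..1} \<times> UNIV)
      (\<lambda>(s, t). m (of_real s) * e (of_real s) t * q (of_real s) t)"
    unfolding case_prod_beta q_def e_def l_def
    by (intro continuous_intros contP contB
        continuous_on_compose2[OF cm] continuous_on_compose2[OF c\<alpha>] continuous_on_compose2[OF c\<beta>]) auto

  \<comment> \<open>One bound \<open>A\<close> for all coefficients on the compact path gives a dominating function.\<close>
  define h where "h s = 1 + cmod (\<alpha> (of_real s)) + cmod (\<beta> (of_real s))
      + cmod (2 * of_real pi * P (of_real s)) + cmod (2 * of_real pi * B (of_real s)) + cmod (m (of_real s))"
    for s :: real
  have "continuous_on {0..1} h"
    unfolding h_def by (intro continuous_intros c\<alpha> c\<beta> cm contP contB)
  then have "bounded (h ` {0..1})"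
    by (intro compact_imp_bounded compact_continuous_image) auto
  then obtain A where hA: "\<And>s. s \<in> {0..1} \<Longrightarrow> h s \<le> A"
    unfolding bounded_iff by (metis abs_le_D1 imageI real_norm_def)
  have le_A: "1 \<le> A" "cmod (\<alpha> (of_real s)) \<le> A" "cmod (\<beta> (of_real s)) \<le> A"
      "cmod (2 * of_real pi * P (of_real s)) \<le> A" "cmod (2 * of_real pi * B (of_real s)) \<le> A"
      "cmod (m (of_real s)) \<le> A"
    if "s \<in> {0..1}" for s
    using hA[OF that] norm_ge_zero[of "\<alpha> (of_real s)"] norm_ge_zero[of "\<beta> (of_real s)"]
      norm_ge_zero[of "m (of_real s)"] norm_ge_zero[of "2 * of_real pi * P (of_real s)"]
      norm_ge_zero[of "2 * of_real pi * B (of_real s)"]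
    unfolding h_def by linarith+
  have A1: "A \<ge> 1" using le_A(1)[of 0] by simp

  \<comment> \<open>The summand \<open>2\<close> absorbs the polynomial factors \<open>l\<close> and \<open>q\<close>, of degree at most two in \<open>t\<close>, via
    \<open>1 + \<bar>t\<bar> \<le> exp \<bar>t\<bar>\<close>.\<close>
  define M where "M = 2 * pi * cmod b + 2"
  define g where "g t = 2 * A^3 * exp (M\<^sup>2 / (8 * r)) * exp (- r * t\<^sup>2)" for t :: real
  have g_int: "integrable lborel g"
    unfolding g_def by (intro integrable_mult_right integrable_exp_neg_square r)
  have e_le: "cmod (e (of_real s) t) * exp (2 * \<bar>t\<bar>) \<le> exp (M\<^sup>2 / (8 * r)) * exp (- r * t\<^sup>2)"
    if s: "s \<in> {0..1}" for s t
  proof -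
    have "s * (Re b * t) \<le> s * (cmod b * \<bar>t\<bar>)"
      using s abs_Re_le_cmod[of b] mult_mono[of "\<bar>Re b\<bar>" "cmod b" "\<bar>t\<bar>" "\<bar>t\<bar>"]
      by (intro mult_left_mono) (auto simp: abs_mult[symmetric])
    also have "\<dots> \<le> 1 * (cmod b * \<bar>t\<bar>)"
      using s by (intro mult_right_mono) auto
    finally have "2 * pi * (s * (Re b * t)) \<le> 2 * pi * (cmod b * \<bar>t\<bar>)" by simp
    moreover have "pi * (r * t\<^sup>2) \<le> pi * (Re (P (of_real s)) * t\<^sup>2)"
      using ReP[OF s] by (intro mult_left_mono mult_right_mono) auto
    moreover have "cmod (e (of_real s) t) = exp (- pi * (Re (P (of_real s)) * t\<^sup>2) + 2 * pi * (s * (Re b * t)))"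
      by (simp add: e_def B_def norm_exp_eq_Re Re_power2 Im_power2 flip: of_real_power)
    moreover have "- pi * r * t\<^sup>2 + M * \<bar>t\<bar> = - (pi * (r * t\<^sup>2)) + 2 * pi * (cmod b * \<bar>t\<bar>) + 2 * \<bar>t\<bar>"
      by (simp add: M_def algebra_simps)
    ultimately have "cmod (e (of_real s) t) * exp (2 * \<bar>t\<bar>) \<le> exp (- pi * r * t\<^sup>2 + M * \<bar>t\<bar>)"
      by (simp only: exp_add[symmetric] exp_le_cancel_iff)
    also have "\<dots> \<le> exp (M\<^sup>2 / (8 * r)) * exp (- r * t\<^sup>2)"
      by (rule gauss_dominates[OF r])
    finally show ?thesis .
  qed
  have me_le: "cmod (m (of_real s) * e (of_real s) t * x) \<le> g t"
    if s: "s \<in> {0..1}" and x: "cmod x \<le> 2 * A\<^sup>2 * exp (2 * \<bar>t\<bar>)" for s t x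
  proof -
    have "cmod (m (of_real s) * e (of_real s) t * x)
        \<le> A * cmod (e (of_real s) t) * (2 * A\<^sup>2 * exp (2 * \<bar>t\<bar>))"
      unfolding norm_mult using A1 x le_A(6)[OF s] by (intro mult_mono) auto
    also have "\<dots> = 2 * A^3 * (cmod (e (of_real s) t) * exp (2 * \<bar>t\<bar>))"
      by (simp add: power2_eq_square power3_eq_cube)
    also have "\<dots> \<le> 2 * A^3 * (exp (M\<^sup>2 / (8 * r)) * exp (- r * t\<^sup>2))"
      using A1 by (intro mult_left_mono e_le s) auto
    finally show ?thesis by (simp add: g_def)
  qed
  have lin: "cmod x * \<bar>t\<bar> + cmod y \<le> A * exp \<bar>t\<bar>" if "cmod x \<le> A" "cmod y \<le> A" for x y :: complex and t :: real
  proof -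
    have "cmod x * \<bar>t\<bar> + cmod y \<le> A * \<bar>t\<bar> + A" using that by (intro add_mono mult_right_mono) auto
    also have "\<dots> = A * (1 + \<bar>t\<bar>)" by (simp add: algebra_simps)
    also have "\<dots> \<le> A * exp \<bar>t\<bar>" using A1 by (intro mult_left_mono exp_ge_add_one_self_aux) auto
    finally show ?thesis .
  qed
  have e2: "exp (2 * \<bar>t\<bar>) = exp \<bar>t\<bar> * exp \<bar>t\<bar>" for t :: real
    by (simp add: exp_add[symmetric])
  have l_le: "cmod (l (of_real s) t) \<le> A * exp \<bar>t\<bar>" if s: "s \<in> {0..1}" for s t
    using norm_triangle_ineq[of "\<alpha> (of_real s) * of_real t" "\<beta> (of_real s)"] lin[OF le_A(2,3)[OF s], of t]
    by (simp add: l_def norm_mult)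
  have AA: "A \<le> A\<^sup>2" using A1 by (simp add: power2_eq_square)
  have l_le': "cmod (l (of_real s) t) \<le> 2 * A\<^sup>2 * exp (2 * \<bar>t\<bar>)" if s: "s \<in> {0..1}" for s t
    using A1 AA by (intro order_trans[OF l_le[OF s]] mult_mono) auto
  have q_le: "cmod (q (of_real s) t) \<le> 2 * A\<^sup>2 * exp (2 * \<bar>t\<bar>)" if s: "s \<in> {0..1}" for s t
  proof -
    let ?w = "- 2 * of_real pi * P (of_real s) * of_real t + 2 * of_real pi * B (of_real s)"
    have "cmod ?w \<le> A * exp \<bar>t\<bar>"
      using norm_triangle_ineq[of "- 2 * of_real pi * P (of_real s) * of_real t" "2 * of_real pi * B (of_real s)"]
        lin[OF le_A(4,5)[OF s], of t] by (simp add: norm_mult)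
    then have "cmod (l (of_real s) t) * cmod ?w \<le> (A * exp \<bar>t\<bar>) * (A * exp \<bar>t\<bar>)"
      using A1 by (intro mult_mono l_le s) auto
    also have "\<dots> = A\<^sup>2 * exp (2 * \<bar>t\<bar>)" by (simp add: e2 power2_eq_square)
    finally have "cmod (l (of_real s) t * ?w) \<le> A\<^sup>2 * exp (2 * \<bar>t\<bar>)" by (simp add: norm_mult)
    moreover have "cmod (\<alpha> (of_real s)) \<le> A\<^sup>2 * exp (2 * \<bar>t\<bar>)"
    proof -
      have "A * 1 \<le> A\<^sup>2 * exp (2 * \<bar>t\<bar>)" using A1 AA by (intro mult_mono) auto
      with le_A(2)[OF s] show ?thesis by simp
    qed
    ultimately show ?thesis
      using norm_triangle_ineq[of "\<alpha> (of_real s)" "l (of_real s) t * ?w"] by (simp add: q_def)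
  qed
  have e_int: "integrable lborel (e (of_real s))" if s: "s \<in> {0..1}" for s
  proof (rule Bochner_Integration.integrable_bound[OF g_int], goal_cases)
    case 1
    have "continuous_on UNIV (e (of_real s))" unfolding e_def by (intro continuous_intros)
    then show ?case using borel_measurable_continuous_onI by auto
  next
    case 2
    have "cmod (e (of_real s) t) \<le> \<bar>g t\<bar>" for t
    proof -
      have "cmod (e (of_real s) t) * 1 \<le> cmod (e (of_real s) t) * exp (2 * \<bar>t\<bar>)"
        by (intro mult_left_mono) auto
      also have "\<dots> \<le> exp (M\<^sup>2 / (8 * r)) * exp (- r * t\<^sup>2)" by (rule e_le[OF s])
      also have "\<dots> \<le> 2 * A^3 * (exp (M\<^sup>2 / (8 * r)) * exp (- r * t\<^sup>2))"
        using one_le_power[OF A1, of 3] mult_right_mono[of 1 "2 * A^3" "exp (M\<^sup>2 / (8 * r)) * exp (- r * t\<^sup>2)"]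
        by simp
      finally show ?thesis by (simp add: g_def)
    qed
    then show ?case by simp
  qed
  have "(LINT t|lborel. m (of_real 1) * e (of_real 1) t) = (LINT t|lborel. m (of_real 0) * e (of_real 0) t)"
  proof (rule integral_deformation[where
      K = "\<lambda>s t. m (of_real s) * e (of_real s) t" and g = g and
      k = "\<lambda>s t. m (of_real s) * e (of_real s) t * q (of_real s) t" and
      L = "\<lambda>s t. m (of_real s) * e (of_real s) t * l (of_real s) t"])
    show "(g \<longlongrightarrow> 0) at_top" "(g \<longlongrightarrow> 0) at_bot"
      unfolding g_def by (rule exp_neg_square_tendsto_0[OF r])+
  qed (use dK dL ck me_le q_le l_le' g_int e_int[of 0] e_int[of 1] in auto)
  also have "\<dots> = (LINT t|lborel. of_real (exp (- pi * t\<^sup>2)))"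
    by (simp add: m_def e_def P_def B_def flip: exp_of_real)
  also have "\<dots> = 1"
    by (simp only: integral_complex_of_real gauss_integral_real of_real_1)
  finally have "m 1 * (LINT t|lborel. e 1 t) = 1" by simp
  moreover have "m 1 * (exp (of_real pi * b\<^sup>2 / p) / csqrt p) = 1"
    using assms by (auto simp: m_def P_def B_def exp_minus)
  ultimately have "(LINT t|lborel. e 1 t) = exp (of_real pi * b\<^sup>2 / p) / csqrt p"
    by (metis mult_cancel_left mult_zero_left zero_neq_one)
  then show "(LINT t|lborel. exp (- of_real pi * p * (of_real t)\<^sup>2 + 2 * of_real pi * b * of_real t))
        = exp (of_real pi * b\<^sup>2 / p) / csqrt p"
    by (simp add: e_def P_def B_def)
  show "integrable lborel (\<lambda>t. exp (- of_real pi * p * (of_real t)\<^sup>2 + 2 * of_real pi * b * of_real t))"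
    using e_int[of 1] by (simp add: e_def[abs_def] P_def B_def)
qed

section \<open>Exponential sums and their moduli\<close>

text \<open>
  Induction on the number of frequencies: dividing by one of the exponentials makes its term
  constant, and differentiating removes it while multiplying the other coefficients by nonzero
  differences of frequencies.
\<close>
lemma exponentials_linearly_independent:
  fixes w d :: "'a \<Rightarrow> complex"
  assumes "finite I" "inj_on w I"
    and "\<And>x::real. (\<Sum>i\<in>I. d i * exp (w i * of_real x)) = 0"
  shows "\<forall>i\<in>I. d i = 0"
  using assms
proof (induction I arbitrary: d rule: finite_induct)
  case (insert j I)
  have eq: "d j + (\<Sum>i\<in>I. d i * exp ((w i - w j) * of_real x)) = 0" for x
  proof -
    have "0 = exp (- w j * of_real x) * (\<Sum>i\<in>insert j I. d i * exp (w i * of_real x))"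
      by (simp only: insert.prems(2) mult_zero_right)
    also have "\<dots> = (\<Sum>i\<in>insert j I. d i * exp ((w i - w j) * of_real x))"
      by (simp add: sum_distrib_left algebra_simps exp_add exp_diff exp_minus field_simps
            del: sum.insert)
    finally show ?thesis using insert.hyps by simp
  qed
  have deriv: "(\<Sum>i\<in>I. d i * (w i - w j) * exp (w i * of_real x)) = 0" for x
  proof -
    have "((\<lambda>x. d j + (\<Sum>i\<in>I. d i * exp ((w i - w j) * of_real x))) has_vector_derivative
        (\<Sum>i\<in>I. d i * (w i - w j) * exp ((w i - w j) * of_real x))) (at x)"
      by (rule has_vector_derivative_real_field)
         (auto intro!: derivative_eq_intros sum.cong simp: algebra_simps)
    moreover have "((\<lambda>x. d j + (\<Sum>i\<in>I. d i * exp ((w i - w j) * of_real x))) has_vector_derivative 0) (at x)"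
      by (simp add: eq)
    ultimately have "(\<Sum>i\<in>I. d i * (w i - w j) * exp ((w i - w j) * of_real x)) = 0"
      by (rule vector_derivative_unique_at)
    then have "exp (w j * of_real x) * (\<Sum>i\<in>I. d i * (w i - w j) * exp ((w i - w j) * of_real x)) = 0"
      by simp
    then show ?thesis
      by (simp add: sum_distrib_left exp_diff left_diff_distrib mult.left_commute)
  qed
  have "\<forall>i\<in>I. d i * (w i - w j) = 0"
    using insert.IH[OF _ deriv] insert.prems(1) by (simp add: inj_on_insert)
  moreover have "w i \<noteq> w j" if "i \<in> I" for i
    using that insert.prems(1) insert.hyps(2) by (auto simp: inj_on_def)
  ultimately have "\<forall>i\<in>I. d i = 0" by auto
  with eq[of 0] show ?case by auto
qed auto

text \<open>
  The real part of \<open>w * a + cnj w * b\<close> is \<open>Re w * (a + b)\<close> and its imaginary part is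
  \<open>Im w * (a - b)\<close>, so this frequency recovers both \<open>a\<close> and \<open>b\<close>.
\<close>
lemma modulus_of_exponential_sum_determines_products:
  fixes D E :: "real \<Rightarrow> complex" and w :: complex
  assumes S: "finite S" and w: "Re w \<noteq> 0" "Im w \<noteq> 0"
    and eq: "\<And>x::real. cmod (\<Sum>a\<in>S. D a * exp (w * of_real a * of_real x))
                      = cmod (\<Sum>a\<in>S. E a * exp (w * of_real a * of_real x))"
    and ab: "a \<in> S" "b \<in> S"
  shows "D a * cnj (D b) = E a * cnj (E b)"
proof -
  define f where "f = (\<lambda>(a, b). w * of_real a + cnj w * of_real b)"
  have inj: "inj_on f (S \<times> S)"
  proof (rule inj_onI, clarify)
    fix a b a' b' :: real
    assume "f (a, b) = f (a', b')"
    then have "Re w * a + Re w * b = Re w * a' + Re w * b'"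
      and "Im w * a - Im w * b = Im w * a' - Im w * b'"
      by (simp_all add: f_def complex_eq_iff)
    then have "Re w * (a + b) = Re w * (a' + b')" "Im w * (a - b) = Im w * (a' - b')"
      by (simp_all add: algebra_simps)
    then have "a + b = a' + b'" "a - b = a' - b'"
      using w by simp_all
    then show "a = a' \<and> b = b'" by simp
  qed
  have square: "of_real ((cmod (\<Sum>a\<in>S. G a * exp (w * of_real a * of_real x)))\<^sup>2)
      = (\<Sum>i\<in>S \<times> S. G (fst i) * cnj (G (snd i)) * exp (f i * of_real x))"
    for G :: "real \<Rightarrow> complex" and x :: real
    unfolding complex_norm_square cnj_sum sum_product sum.cartesian_product
    by (rule sum.cong) (auto simp: f_def exp_cnj algebra_simps exp_add)
  have "(\<Sum>i\<in>S \<times> S. (D (fst i) * cnj (D (snd i)) - E (fst i) * cnj (E (snd i))) * exp (f i * of_real x)) = 0" for x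
    using square[of D x] square[of E x]
    by (simp add: eq left_diff_distrib sum_subtractf)
  from exponentials_linearly_independent[OF _ inj this] S ab show ?thesis
    by auto
qed

text \<open>
  The products \<open>D a * cnj (D b)\<close> form the Hermitian matrix of rank at most one built from \<open>D\<close>; any of its
  nonzero columns is a multiple of \<open>D\<close>, and its diagonal fixes the modulus of that multiple.
\<close>
lemma equal_products_imp_unimodular_multiple:
  fixes D E :: "'a \<Rightarrow> complex"
  assumes "\<And>a b. a \<in> S \<Longrightarrow> b \<in> S \<Longrightarrow> D a * cnj (D b) = E a * cnj (E b)"
  shows "\<exists>c. cmod c = 1 \<and> (\<forall>a\<in>S. D a = c * E a)"
proof (cases "\<exists>b\<in>S. D b \<noteq> 0")
  case True
  then obtain b where b: "b \<in> S" "D b \<noteq> 0" by blast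
  have "of_real ((cmod (D b))\<^sup>2) = (of_real ((cmod (E b))\<^sup>2) :: complex)"
    unfolding complex_norm_square using assms[OF b(1) b(1)] .
  then have norm: "cmod (D b) = cmod (E b)"
    by (simp only: of_real_eq_iff power2_eq_iff_nonneg norm_ge_zero)
  show ?thesis
  proof (intro exI[of _ "cnj (E b) / cnj (D b)"] conjI ballI)
    show "cmod (cnj (E b) / cnj (D b)) = 1"
      using norm b by (auto simp: norm_divide)
    show "D a = cnj (E b) / cnj (D b) * E a" if "a \<in> S" for a
      using assms[OF that b(1)] b(2) by (simp add: field_simps)
  qed
next
  case False
  then have "E a = 0" if "a \<in> S" for a
    using assms[OF that that] that by auto
  with False show ?thesis by (intro exI[of _ 1]) auto
qed

section \<open>The transform of a combination of shifted Gaussians\<close>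

text \<open>
  Collecting equal shifts makes the frequencies of the transform distinct. The coefficient
  function is extended by zero so that two combinations can be written over a common set of shifts.
\<close>
lemma shifted_gauss_comb_distinct_shifts:
  assumes "shifted_gauss_comb u"
  obtains S C where "finite S" "\<And>a. a \<notin> S \<Longrightarrow> C a = 0"
    "\<And>t. u t = (\<Sum>a\<in>S. C a * of_real (gauss (t - a)))"
proof -
  obtain N :: nat and c s where u: "\<And>t. u t = (\<Sum>j=1..N. c j * of_real (gauss (t - s j)))"
    using assms by (auto simp: shifted_gauss_comb_def)
  define C where "C a = (\<Sum>j\<in>{j\<in>{1..N}. s j = a}. c j)" for a
  have "u t = (\<Sum>a\<in>s ` {1..N}. C a * of_real (gauss (t - a)))" for t
  proof -
    have "u t = (\<Sum>a\<in>s ` {1..N}. \<Sum>j\<in>{j\<in>{1..N}. s j = a}. c j * of_real (gauss (t - s j)))"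
      unfolding u by (rule sum.image_gen) simp
    also have "\<dots> = (\<Sum>a\<in>s ` {1..N}. C a * of_real (gauss (t - a)))"
      unfolding C_def sum_distrib_right by (intro sum.cong) auto
    finally show ?thesis .
  qed
  moreover have "C a = 0" if "a \<notin> s ` {1..N}" for a
    using that unfolding C_def by (intro sum.neutral) auto
  ultimately show ?thesis by (intro that[of "s ` {1..N}" C]) auto
qed

text \<open>
  The chirp \<open>exp (- \<i> \<pi> t\<^sup>2 cot \<alpha>)\<close> only turns the quadratic coefficient of each Gaussian into \<open>p\<close>,
  so each summand integrates to \<open>exp (\<pi> (a - \<i> x)\<^sup>2 / p) / csqrt p\<close>. Expanding the square separates a
  factor independent of the shift \<open>a\<close>, a nonzero weight independent of \<open>x\<close>, and an exponential
  whose exponent is bilinear in \<open>a\<close> and \<open>x\<close>. Evaluating at \<open>x * sin \<alpha>\<close> cancels the division by \<open>sin \<alpha>\<close> in the kernel.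
\<close>
lemma frft_gauss_sum:
  fixes C :: "real \<Rightarrow> complex"
  assumes sin: "sin \<alpha> \<noteq> 0"
  defines "p \<equiv> Complex 1 (cot \<alpha>)"
  shows "frft \<alpha> (\<lambda>t. \<Sum>a\<in>S. C a * of_real (gauss (t - a))) (x * sin \<alpha>) =
    frft_const \<alpha> * exp (- \<i> * of_real (pi * (x * sin \<alpha>)\<^sup>2 * cot \<alpha>)) *
      (exp (- of_real (pi * x\<^sup>2) / p) / csqrt p) *
    (\<Sum>a\<in>S. C a * exp (of_real (pi * a\<^sup>2) / p - of_real (pi * a\<^sup>2))
                * exp (- 2 * of_real pi * \<i> / p * of_real a * of_real x))"
proof -
  have p: "Re p > 0" "p \<noteq> 0" by (auto simp: p_def complex_eq_iff)
  define h where "h a t = exp (- of_real pi * p * (of_real t)\<^sup>2 + 2 * of_real pi * (of_real a - \<i> * of_real x) * of_real t)"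
    for a t :: real
  have h_int: "integrable lborel (h a)" for a
    unfolding h_def by (rule gaussian_integrable[OF p(1)])
  have pi_p: "p = 1 + \<i> * of_real (cot \<alpha>)" by (simp add: p_def complex_eq_iff)
  have summand: "of_real (gauss (t - a)) * exp (- \<i> * of_real (pi * t\<^sup>2 * cot \<alpha>))
      * exp (- 2 * \<i> * of_real (pi * t * (x * sin \<alpha>) / sin \<alpha>)) = exp (- of_real (pi * a\<^sup>2)) * h a t" for t a
    unfolding h_def gauss_def pi_p exp_of_real[symmetric] exp_add[symmetric] using sin
    by (intro arg_cong[of _ _ exp]) (simp add: power2_eq_square algebra_simps)
  have "(\<Sum>a\<in>S. C a * of_real (gauss (t - a))) * exp (- \<i> * of_real (pi * t\<^sup>2 * cot \<alpha>))
      * exp (- 2 * \<i> * of_real (pi * t * (x * sin \<alpha>) / sin \<alpha>))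
      = (\<Sum>a\<in>S. C a * exp (- of_real (pi * a\<^sup>2)) * h a t)" for t
    unfolding sum_distrib_right by (intro sum.cong refl) (simp only: mult.assoc summand[unfolded mult.assoc])
  then have "(LINT t|lborel. (\<Sum>a\<in>S. C a * of_real (gauss (t - a))) * exp (- \<i> * of_real (pi * t\<^sup>2 * cot \<alpha>))
      * exp (- 2 * \<i> * of_real (pi * t * (x * sin \<alpha>) / sin \<alpha>)))
      = (LINT t|lborel. (\<Sum>a\<in>S. C a * exp (- of_real (pi * a\<^sup>2)) * h a t))"
    by simp
  also have "\<dots> = (\<Sum>a\<in>S. C a * exp (- of_real (pi * a\<^sup>2)) * (LINT t|lborel. h a t))"
    by (simp add: Bochner_Integration.integral_sum h_int)
  also have "\<dots> = (\<Sum>a\<in>S. C a * exp (- of_real (pi * a\<^sup>2)) * (exp (of_real pi * (of_real a - \<i> * of_real x)\<^sup>2 / p) / csqrt p))"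
    unfolding h_def gaussian_integral_eq[OF p(1)] ..
  also have "\<dots> = (\<Sum>a\<in>S. exp (- of_real (pi * x\<^sup>2) / p) / csqrt p *
      (C a * exp (of_real (pi * a\<^sup>2) / p - of_real (pi * a\<^sup>2)) * exp (- 2 * of_real pi * \<i> / p * of_real a * of_real x)))"
  proof (rule sum.cong[OF refl])
    fix a
    have "exp (- of_real (pi * a\<^sup>2)) * exp (of_real pi * (of_real a - \<i> * of_real x)\<^sup>2 / p)
        = exp (- of_real (pi * x\<^sup>2) / p) * exp (of_real (pi * a\<^sup>2) / p - of_real (pi * a\<^sup>2))
          * exp (- 2 * of_real pi * \<i> / p * of_real a * of_real x)"
      unfolding exp_add[symmetric]
      by (intro arg_cong[of _ _ exp]) (use p(2) in \<open>simp add: power2_eq_square field_simps\<close>)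
    then show "C a * exp (- of_real (pi * a\<^sup>2)) * (exp (of_real pi * (of_real a - \<i> * of_real x)\<^sup>2 / p) / csqrt p)
      = exp (- of_real (pi * x\<^sup>2) / p) / csqrt p *
        (C a * exp (of_real (pi * a\<^sup>2) / p - of_real (pi * a\<^sup>2)) * exp (- 2 * of_real pi * \<i> / p * of_real a * of_real x))"
      by (simp add: mult.assoc mult.left_commute)
  qed
  finally show ?thesis
    unfolding frft_def by (simp only: sum_distrib_left[symmetric] mult.assoc)
qed

section \<open>Uniqueness up to a unimodular factor\<close>

theorem theorem5p15:
  fixes \<alpha> :: real and u v :: "real \<Rightarrow> complex"
  assumes "\<And>k::int. \<alpha> \<noteq> of_int k * (pi / 2)"
    and "shifted_gauss_comb u"
    and "shifted_gauss_comb v"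
    and "\<And>\<xi>. cmod (frft \<alpha> v \<xi>) = cmod (frft \<alpha> u \<xi>)"
  shows "\<exists>c::complex. cmod c = 1 \<and> (\<forall>t. v t = c * u t)"
proof -
  have sin: "sin \<alpha> \<noteq> 0" and "cos \<alpha> \<noteq> 0"
    using assms(1) by (auto simp: sin_zero_iff_int cos_zero_iff_int)
  then have cot: "cot \<alpha> \<noteq> 0" by (simp add: cot_def)
  define p where "p = Complex 1 (cot \<alpha>)"
  define w where "w = - 2 * of_real pi * \<i> / p"
  define q where "q a = exp (of_real (pi * a\<^sup>2) / p - of_real (pi * a\<^sup>2))" for a :: real
  have p0: "p \<noteq> 0" by (simp add: p_def complex_eq_iff)
  have w: "Re w \<noteq> 0" "Im w \<noteq> 0"
  proof -
    have "1 + (cot \<alpha>)\<^sup>2 > 0" by (simp add: add_pos_nonneg)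
    then show "Re w \<noteq> 0" "Im w \<noteq> 0"
      using cot by (auto simp: w_def p_def Re_divide Im_divide)
  qed

  obtain S1 C1 where 1: "finite S1" "\<And>a. a \<notin> S1 \<Longrightarrow> C1 a = 0"
    "\<And>t. u t = (\<Sum>a\<in>S1. C1 a * of_real (gauss (t - a)))"
    using shifted_gauss_comb_distinct_shifts[OF assms(2)] by metis
  obtain S2 C2 where 2: "finite S2" "\<And>a. a \<notin> S2 \<Longrightarrow> C2 a = 0"
    "\<And>t. v t = (\<Sum>a\<in>S2. C2 a * of_real (gauss (t - a)))"
    using shifted_gauss_comb_distinct_shifts[OF assms(3)] by metis
  define S where "S = S1 \<union> S2"
  have S: "finite S" using 1 2 by (simp add: S_def)
  have u: "u = (\<lambda>t. \<Sum>a\<in>S. C1 a * of_real (gauss (t - a)))"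
    unfolding 1(3) using 1(2) S by (intro ext sum.mono_neutral_left) (auto simp: S_def)
  have v: "v = (\<lambda>t. \<Sum>a\<in>S. C2 a * of_real (gauss (t - a)))"
    unfolding 2(3) using 2(2) S by (intro ext sum.mono_neutral_left) (auto simp: S_def)

  have "cmod (\<Sum>a\<in>S. C2 a * q a * exp (w * of_real a * of_real x))
      = cmod (\<Sum>a\<in>S. C1 a * q a * exp (w * of_real a * of_real x))" for x
  proof -
    let ?H = "frft_const \<alpha> * exp (- \<i> * of_real (pi * (x * sin \<alpha>)\<^sup>2 * cot \<alpha>)) *
      (exp (- of_real (pi * x\<^sup>2) / p) / csqrt p)"
    have "cmod ?H * cmod (\<Sum>a\<in>S. C2 a * q a * exp (w * of_real a * of_real x))
        = cmod ?H * cmod (\<Sum>a\<in>S. C1 a * q a * exp (w * of_real a * of_real x))"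
      using assms(4)[of "x * sin \<alpha>"]
      unfolding u v frft_gauss_sum[OF sin] p_def[symmetric] q_def[symmetric] w_def[symmetric] norm_mult[symmetric] .
    moreover have "?H \<noteq> 0" using sin p0 by (simp add: frft_const_def)
    ultimately show ?thesis by (simp only: mult_cancel_left norm_eq_zero) blast
  qed
  from modulus_of_exponential_sum_determines_products[OF S w this]
  obtain c where c: "cmod c = 1" "\<And>a. a \<in> S \<Longrightarrow> C2 a * q a = c * (C1 a * q a)"
    using equal_products_imp_unimodular_multiple[of S "\<lambda>a. C2 a * q a" "\<lambda>a. C1 a * q a"] by blast
  have "C2 a = c * C1 a" if "a \<in> S" for a
    using c(2)[OF that] by (simp add: q_def)
  then have "v t = c * u t" for t
    unfolding u v sum_distrib_left by (intro sum.cong) auto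
  with c(1) show ?thesis by blast
qed

end
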